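(* Let $\mu$ be a Borel measure on an interval $\Omega\subset\mathbb{R}$ that does not change sign, has finite moments and infinite support, and let $\{P_k\}_{k\ge0}$ be its monic orthogonal polynomials. For $k\ge1$, the roots $\{\alpha_{k,l}\}_{l=1}^k$ of $P_k(x)$ are the $k$ points for a quadrature of $\mu$ with precision $2k-1$. Namely, there exist coefficients $\lambda_{k,1},\dots,\lambda_{k,k}$ such that $$\int_\Omega x^j\,d\mu(x)=\sum_{l=1}^k\lambda_{k,l}\,\alpha_{k,l}^{\,j},\qquad 0\le j\le 2k-1.$$
   Context: The monic orthogonal polynomials $P_k$, $\deg P_k=k$, are defined by $\int_\Omega P_k(x)x^l\,d\mu(x)=0$ for $0\le l<k$. *)

theory Defs
  imports "HOL-Analysis.Analysis" "HOL-Computational_Algebra.Polynomial"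
begin

text \<open>
  Signed measures on a measurable space. Only the space and the \<open>\<sigma>\<close>-algebra of the
  argument \<open>M\<close> are used, not its measure.
\<close>

definition signed_measure :: "'a measure \<Rightarrow> ('a set \<Rightarrow> ereal) \<Rightarrow> bool" where
  "signed_measure M \<nu> \<longleftrightarrow>
     \<nu> {} = 0 \<and>
     ((\<forall>A\<in>sets M. \<nu> A \<noteq> \<infinity>) \<or> (\<forall>A\<in>sets M. \<nu> A \<noteq> - \<infinity>)) \<and>
     (\<forall>A :: nat \<Rightarrow> 'a set. range A \<subseteq> sets M \<longrightarrow> disjoint_family A \<longrightarrow>
        (\<lambda>i. \<nu> (A i)) sums \<nu> (\<Union>i. A i))"

text \<open>
  The positive part of the Jordan decomposition. Since \<open>e2ennreal\<close> sends negative numbers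
  to 0 and \<open>\<nu> {} = 0\<close>, the supremum is that of the values of \<open>\<nu>\<close> on
  measurable subsets of \<open>A\<close>.
\<close>

definition pos_part :: "'a measure \<Rightarrow> ('a set \<Rightarrow> ereal) \<Rightarrow> 'a measure" where
  "pos_part M \<nu> =
     measure_of (space M) (sets M) (\<lambda>A. SUP B\<in>{B \<in> sets M. B \<subseteq> A}. e2ennreal (\<nu> B))"

definition neg_part :: "'a measure \<Rightarrow> ('a set \<Rightarrow> ereal) \<Rightarrow> 'a measure" where
  "neg_part M \<nu> = pos_part M (\<lambda>A. - \<nu> A)"

definition signed_integrable :: "'a measure \<Rightarrow> ('a set \<Rightarrow> ereal) \<Rightarrow> ('a \<Rightarrow> real) \<Rightarrow> bool" where
  "signed_integrable M \<nu> f \<longleftrightarrow> integrable (pos_part M \<nu>) f \<and> integrable (neg_part M \<nu>) f"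

definition signed_integral :: "'a measure \<Rightarrow> ('a set \<Rightarrow> ereal) \<Rightarrow> ('a \<Rightarrow> real) \<Rightarrow> real" where
  "signed_integral M \<nu> f = (LINT x|pos_part M \<nu>. f x) - (LINT x|neg_part M \<nu>. f x)"

definition no_sign_change :: "'a measure \<Rightarrow> ('a set \<Rightarrow> ereal) \<Rightarrow> bool" where
  "no_sign_change M \<nu> \<longleftrightarrow> (\<forall>A\<in>sets M. 0 \<le> \<nu> A) \<or> (\<forall>A\<in>sets M. \<nu> A \<le> 0)"

abbreviation borel_on :: "real set \<Rightarrow> real measure" where
  "borel_on \<Omega> \<equiv> restrict_space borel \<Omega>"

definition finite_moments :: "real set \<Rightarrow> (real set \<Rightarrow> ereal) \<Rightarrow> bool" where
  "finite_moments \<Omega> \<mu> \<longleftrightarrow> (\<forall>j. signed_integrable (borel_on \<Omega>) \<mu> (\<lambda>x. x ^ j))"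

text \<open>The topological support (relative to \<open>\<Omega>\<close>) of the total variation of \<open>\<mu>\<close>.\<close>

definition measure_support :: "real set \<Rightarrow> (real set \<Rightarrow> ereal) \<Rightarrow> real set" where
  "measure_support \<Omega> \<mu> =
     {x \<in> \<Omega>. \<forall>U. open U \<longrightarrow> x \<in> U \<longrightarrow>
        emeasure (pos_part (borel_on \<Omega>) \<mu>) (U \<inter> \<Omega>) +
        emeasure (neg_part (borel_on \<Omega>) \<mu>) (U \<inter> \<Omega>) \<noteq> 0}"

definition monic_orthogonal_polys ::
    "real set \<Rightarrow> (real set \<Rightarrow> ereal) \<Rightarrow> (nat \<Rightarrow> real poly) \<Rightarrow> bool" where
  "monic_orthogonal_polys \<Omega> \<mu> P \<longleftrightarrow>
     (\<forall>k. degree (P k) = k \<and> lead_coeff (P k) = 1 \<and>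
        (\<forall>l<k. signed_integral (borel_on \<Omega>) \<mu> (\<lambda>x. poly (P k) x * x ^ l) = 0))"

text \<open>
  Consistency with the library: a measure in the library's sense is a signed measure of
  constant sign which is its own positive part, and its negative part vanishes; for the
  opposite sign the two parts are exchanged.
\<close>

lemma signed_measure_emeasure: "signed_measure M (\<lambda>A. enn2ereal (emeasure M A))"
  unfolding signed_measure_def
proof (intro conjI allI impI)
  show "(\<forall>A\<in>sets M. enn2ereal (emeasure M A) \<noteq> \<infinity>) \<or>
        (\<forall>A\<in>sets M. enn2ereal (emeasure M A) \<noteq> - \<infinity>)"
    using enn2ereal_nonneg by force
next
  fix A :: "nat \<Rightarrow> 'a set"
  assume A: "range A \<subseteq> sets M" "disjoint_family A"
  have "(\<lambda>i. emeasure M (A i)) sums emeasure M (\<Union>i. A i)"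
    using suminf_emeasure[OF A] by (metis summableI summable_sums)
  then show "(\<lambda>i. enn2ereal (emeasure M (A i))) sums enn2ereal (emeasure M (\<Union>i. A i))"
    unfolding sums_def by (simp add: sum_enn2ereal tendsto_enn2ereal_iff)
qed (simp add: zero_ennreal.rep_eq)

lemma pos_part_emeasure: "pos_part M (\<lambda>A. enn2ereal (emeasure M A)) = M"
proof -
  have "(SUP B\<in>{B \<in> sets M. B \<subseteq> A}. e2ennreal (enn2ereal (emeasure M B))) = emeasure M A"
    if "A \<in> sets M" for A
    using that by (intro antisym SUP_least SUP_upper2[of A]) (auto intro: emeasure_mono)
  then have "pos_part M (\<lambda>A. enn2ereal (emeasure M A)) =
      measure_of (space M) (sets M) (emeasure M)"
    unfolding pos_part_def
    by (intro measure_of_eq) (auto simp: sets.space_closed sets.sigma_sets_eq)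
  then show ?thesis
    by (simp add: measure_of_of_measure)
qed

lemma neg_part_emeasure: "neg_part M (\<lambda>A. enn2ereal (emeasure M A)) = null_measure M"
proof -
  have "(SUP B\<in>{B \<in> sets M. B \<subseteq> A}. e2ennreal (- enn2ereal (emeasure M B))) = 0" for A
    by (auto simp: SUP_eq_iff e2ennreal_neg bot_ennreal intro!: antisym SUP_least)
  then show ?thesis
    unfolding neg_part_def pos_part_def null_measure_def by simp
qed

lemma pos_part_uminus: "pos_part M (\<lambda>A. - \<nu> A) = neg_part M \<nu>"
  and neg_part_uminus: "neg_part M (\<lambda>A. - \<nu> A) = pos_part M \<nu>"
  by (simp_all add: neg_part_def)

end

theory Submission
  imports Defs
begin

text \<open>
  Up to a sign, the integral against \<open>\<mu>\<close> is the integral against a positive measure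
  \<open>N\<close>. On polynomials the latter is a linear functional \<open>L\<close>, and infinite support
  makes it definite: a nonzero polynomial \<open>p \<ge> 0\<close> with \<open>L p = 0\<close> would vanish
  \<open>N\<close>-almost everywhere, so the support would lie among the finitely many roots of
  \<open>p\<close> (\<open>integral_poly_pos\<close>). The rest is algebra of such functionals.

  Let \<open>p\<close> of degree \<open>k\<close> be orthogonal to all polynomials of smaller degree. There is a set
  \<open>Z\<close> of roots of \<open>p\<close> (those of odd multiplicity) such that
  \<open>p * (\<Prod>z\<in>Z. x - z)\<close> does not change sign (\<open>poly_times_roots_no_sign_change\<close>). By
  definiteness \<open>L\<close> does not vanish on this product, so by orthogonality the second
  factor has degree at least \<open>k\<close>. Hence \<open>p\<close> has \<open>k\<close> distinct real roots
  (\<open>card_roots_orthogonal\<close>).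

  For the quadrature, let the coefficients for \<open>L\<close> be its values at the Lagrange
  basis polynomials of the roots. This is exact in degrees below \<open>k\<close> by interpolation. If
  \<open>f\<close> has degree below \<open>2 * k\<close>, then in \<open>f = (f div p) * p + f mod p\<close> the first
  summand vanishes at the nodes, and \<open>L\<close> kills it because \<open>f div p\<close> has degree below
  \<open>k\<close>; the second summand has degree below \<open>k\<close> (\<open>gauss_quadrature\<close>).
\<close>

section \<open>Sign changes of real polynomials\<close>

lemma poly_no_root_no_sign_change:
  fixes p :: "real poly"
  assumes "\<And>x. poly p x \<noteq> 0"
  shows "(\<forall>x. 0 \<le> poly p x) \<or> (\<forall>x. poly p x \<le> 0)"
proof (rule ccontr)
  assume "\<not> ?thesis"
  then obtain x y where xy: "poly p x < 0" "0 < poly p y"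
    by (auto simp: not_le)
  then consider "x < y" | "y < x"
    by (metis less_asym linorder_less_linear)
  then show False
    using assms poly_IVT_pos[of x y p] poly_IVT_neg[of y x p] xy by cases auto
qed

lemma degree_root_product:
  fixes a :: "'b \<Rightarrow> 'a :: idom"
  shows "degree (\<Prod>i\<in>A. [:- a i, 1:]) = card A"
  by (subst degree_prod_eq_sum_degree) auto

text \<open>
  Splitting off the roots one at a time toggles their membership in \<open>Z\<close>, so that
  the set ends up consisting of the roots of odd multiplicity. Dividing out single roots and
  toggling makes it possible to argue without multiplicities.
\<close>

lemma poly_times_roots_no_sign_change:
  fixes p :: "real poly"
  assumes "p \<noteq> 0"
  shows "\<exists>Z \<subseteq> {x. poly p x = 0}.
    (\<forall>x. 0 \<le> poly (p * (\<Prod>z\<in>Z. [:- z, 1:])) x) \<or>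
    (\<forall>x. poly (p * (\<Prod>z\<in>Z. [:- z, 1:])) x \<le> 0)"
  using assms
proof (induction "degree p" arbitrary: p rule: less_induct)
  case less
  show ?case
  proof (cases "\<exists>a. poly p a = 0")
    case False
    then show ?thesis
      using poly_no_root_no_sign_change[of p] by (intro exI[of _ "{}"]) auto
  next
    case True
    then obtain a r where p: "p = [:- a, 1:] * r"
      by (auto simp: poly_eq_0_iff_dvd elim: dvdE)
    with less.prems have "r \<noteq> 0" by auto
    then have "degree r < degree p"
      unfolding p by (subst degree_mult_eq) auto
    with less.hyps \<open>r \<noteq> 0\<close> obtain Z where Z: "Z \<subseteq> {x. poly r x = 0}"
      and sgn: "(\<forall>x. 0 \<le> poly (r * (\<Prod>z\<in>Z. [:- z, 1:])) x) \<or>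
        (\<forall>x. poly (r * (\<Prod>z\<in>Z. [:- z, 1:])) x \<le> 0)"
      by blast
    have fin: "finite Z"
      using Z poly_roots_finite[OF \<open>r \<noteq> 0\<close>] by (rule finite_subset)
    show ?thesis
    proof (cases "a \<in> Z")
      case True
      have "p * (\<Prod>z\<in>Z - {a}. [:- z, 1:]) = r * (\<Prod>z\<in>Z. [:- z, 1:])"
        unfolding p prod.remove[OF fin True] by (simp only: mult_ac)
      then show ?thesis
        using sgn Z p by (intro exI[of _ "Z - {a}"]) auto
    next
      case False
      have "p * (\<Prod>z\<in>insert a Z. [:- z, 1:]) = [:- a, 1:]\<^sup>2 * (r * (\<Prod>z\<in>Z. [:- z, 1:]))"
        unfolding p prod.insert[OF fin False] power2_eq_square by (simp only: mult_ac)
      then have "poly (p * (\<Prod>z\<in>insert a Z. [:- z, 1:])) x =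
          (x - a)\<^sup>2 * poly (r * (\<Prod>z\<in>Z. [:- z, 1:])) x" for x
        by (simp add: poly_power)
      then have "(\<forall>x. 0 \<le> poly (p * (\<Prod>z\<in>insert a Z. [:- z, 1:])) x) \<or>
          (\<forall>x. poly (p * (\<Prod>z\<in>insert a Z. [:- z, 1:])) x \<le> 0)"
        using sgn by (metis mult_nonneg_nonneg mult_nonneg_nonpos zero_le_power2)
      then show ?thesis
        using Z p by (intro exI[of _ "insert a Z"]) auto
    qed
  qed
qed

section \<open>Lagrange interpolation\<close>

definition lagrange_basis :: "('b \<Rightarrow> 'a :: field) \<Rightarrow> 'b set \<Rightarrow> 'b \<Rightarrow> 'a poly" where
  "lagrange_basis a I i =
     smult (inverse (\<Prod>m\<in>I - {i}. a i - a m)) (\<Prod>m\<in>I - {i}. [:- a m, 1:])"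

lemma poly_lagrange_basis:
  assumes "finite I" "inj_on a I" "i \<in> I" "j \<in> I"
  shows "poly (lagrange_basis a I i) (a j) = (if i = j then 1 else 0)"
proof (cases "i = j")
  case True
  have "(\<Prod>m\<in>I - {i}. a i - a m) \<noteq> 0"
    using assms by (auto simp: inj_on_def)
  with True show ?thesis
    by (simp add: lagrange_basis_def poly_prod)
next
  case False
  with assms show ?thesis
    by (auto simp: lagrange_basis_def poly_prod)
qed

lemma degree_lagrange_basis:
  assumes "finite I" "i \<in> I"
  shows "degree (lagrange_basis a I i) < card I"
proof -
  have "degree (lagrange_basis a I i) \<le> card (I - {i})"
    unfolding lagrange_basis_def using degree_smult_le degree_root_product by metis
  also have "\<dots> < card I"
    using assms by (rule card_Diff1_less)
  finally show ?thesis .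
qed

lemma lagrange_interpolation:
  fixes a :: "'b \<Rightarrow> 'a :: field"
  assumes "finite I" "inj_on a I" "degree q < card I"
  shows "q = (\<Sum>i\<in>I. smult (poly q (a i)) (lagrange_basis a I i))"
proof (rule poly_eqI_degree[where A = "a ` I"])
  have card: "card (a ` I) = card I"
    using assms by (simp add: card_image)
  then have I: "I \<noteq> {}"
    using assms by auto
  show "degree q < card (a ` I)"
    using assms card by simp
  show "degree (\<Sum>i\<in>I. smult (poly q (a i)) (lagrange_basis a I i)) < card (a ` I)"
    unfolding card using assms I
    by (intro degree_sum_less le_less_trans[OF degree_smult_le degree_lagrange_basis])
      (auto simp: card_gt_0_iff)
  show "poly q x = poly (\<Sum>i\<in>I. smult (poly q (a i)) (lagrange_basis a I i)) x"
    if "x \<in> a ` I" for x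
    using that assms
    by (auto simp: poly_sum poly_lagrange_basis if_distrib[of "(*) _"] cong: if_cong)
qed

section \<open>Definite functionals on real polynomials\<close>

locale definite_functional =
  fixes L :: "real poly \<Rightarrow> real"
  assumes add: "L (p + q) = L p + L q"
    and smult: "L (smult c p) = c * L p"
    and definite: "p \<noteq> 0 \<Longrightarrow> (\<And>x. 0 \<le> poly p x) \<Longrightarrow> 0 < L p"
begin

lemma zero: "L 0 = 0"
  using smult[of 0 0] by simp

lemma sum: "L (\<Sum>i\<in>A. f i) = (\<Sum>i\<in>A. L (f i))"
  by (induction A rule: infinite_finite_induct) (simp_all add: zero add)

lemma orthogonal_if_monoms:
  assumes "\<And>l. l < k \<Longrightarrow> L (p * monom 1 l) = 0" and "degree q < k"
  shows "L (p * q) = 0"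
proof -
  have "q = (\<Sum>l\<le>degree q. smult (coeff q l) (monom 1 l))"
    using poly_as_sum_of_monoms[of q] by (simp add: smult_monom)
  then have "L (p * q) = L (\<Sum>l\<le>degree q. smult (coeff q l) (p * monom 1 l))"
    by (metis (no_types, lifting) mult_smult_right sum.cong sum_distrib_left)
  also have "\<dots> = 0"
    using assms by (simp add: sum smult)
  finally show ?thesis .
qed

text \<open>
  Definiteness forbids \<open>L (p * q) = 0\<close> when \<open>q\<close> is the monic polynomial with simple
  zeros where \<open>p\<close> changes sign. Hence \<open>p\<close> changes sign at least \<open>degree p\<close> times.
\<close>

lemma card_roots_orthogonal:
  assumes "p \<noteq> 0" and orth: "\<And>q. degree q < degree p \<Longrightarrow> L (p * q) = 0"
  shows "card {x. poly p x = 0} = degree p"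
proof (rule antisym)
  show "card {x. poly p x = 0} \<le> degree p"
    using \<open>p \<noteq> 0\<close> by (rule card_poly_roots_bound)
  obtain Z where Z: "Z \<subseteq> {x. poly p x = 0}"
    and sgn: "(\<forall>x. 0 \<le> poly (p * (\<Prod>z\<in>Z. [:- z, 1:])) x) \<or>
      (\<forall>x. poly (p * (\<Prod>z\<in>Z. [:- z, 1:])) x \<le> 0)"
    using poly_times_roots_no_sign_change[OF \<open>p \<noteq> 0\<close>] by blast
  define q where "q = (\<Prod>z\<in>Z. [:- z, 1:])"
  have fin: "finite {x. poly p x = 0}"
    using \<open>p \<noteq> 0\<close> by (rule poly_roots_finite)
  have "finite Z"
    using Z fin by (rule finite_subset)
  then have "p * q \<noteq> 0"
    using \<open>p \<noteq> 0\<close> by (simp add: q_def)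
  from sgn have "L (p * q) \<noteq> 0"
  proof
    assume "\<forall>x. 0 \<le> poly (p * (\<Prod>z\<in>Z. [:- z, 1:])) x"
    then show ?thesis
      using definite[OF \<open>p * q \<noteq> 0\<close>] by (auto simp: q_def)
  next
    assume "\<forall>x. poly (p * (\<Prod>z\<in>Z. [:- z, 1:])) x \<le> 0"
    then have "0 < L (smult (- 1) (p * q))"
      using \<open>p * q \<noteq> 0\<close> by (intro definite) (auto simp: q_def)
    then show ?thesis
      unfolding smult by simp
  qed
  then have "degree p \<le> degree q"
    using orth[of q] by force
  also have "\<dots> = card Z"
    unfolding q_def by (rule degree_root_product)
  also have "\<dots> \<le> card {x. poly p x = 0}"
    using fin Z by (rule card_mono)
  finally show "degree p \<le> card {x. poly p x = 0}" .
qed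

text \<open>
  Interpolation at \<open>degree p\<close> nodes alone would give exactness only below
  \<open>degree p\<close>; taking the nodes at the roots of the orthogonal \<open>p\<close> makes both sides
  vanish on every \<open>p * q\<close> with \<open>degree q < degree p\<close>, which doubles the range.
\<close>

lemma gauss_quadrature:
  assumes orth: "\<And>q. degree q < degree p \<Longrightarrow> L (p * q) = 0"
    and "finite I" "card I = degree p" "inj_on a I" and root: "\<And>i. i \<in> I \<Longrightarrow> poly p (a i) = 0"
    and f: "degree f < 2 * degree p"
  shows "L f = (\<Sum>i\<in>I. L (lagrange_basis a I i) * poly f (a i))"
proof -
  have "p \<noteq> 0" using f by auto
  have "degree (f div p) < degree p"
  proof (cases "f div p = 0")
    case True
    then show ?thesis
      using f by simp
  next
    case False
    then have "degree (f div p * p) = degree (f div p) + degree p"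
      using \<open>p \<noteq> 0\<close> by (rule degree_mult_eq)
    moreover have "degree (f mod p) \<le> degree p"
      using degree_mod_less[OF \<open>p \<noteq> 0\<close>, of f] by auto
    ultimately show ?thesis
      using f degree_diff_le_max[of f "f mod p"] by (simp add: minus_mod_eq_div_mult)
  qed
  then have quot: "L (p * (f div p)) = 0"
    by (rule orth)
  have rem: "degree (f mod p) < card I"
    using f degree_mod_less'[of p f] \<open>p \<noteq> 0\<close> \<open>card I = degree p\<close> by (cases "f mod p = 0") auto
  have "L f = L (p * (f div p)) + L (f mod p)"
    by (simp flip: add)
  also have "\<dots> = L (\<Sum>i\<in>I. smult (poly (f mod p) (a i)) (lagrange_basis a I i))"
    using quot lagrange_interpolation[OF \<open>finite I\<close> \<open>inj_on a I\<close> rem] by simp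
  also have "\<dots> = (\<Sum>i\<in>I. L (lagrange_basis a I i) * poly (f mod p) (a i))"
    by (simp add: sum smult mult.commute)
  also have "\<dots> = (\<Sum>i\<in>I. L (lagrange_basis a I i) * poly f (a i))"
  proof (rule sum.cong[OF refl])
    fix i assume "i \<in> I"
    have "poly f (a i) = poly (p * (f div p) + f mod p) (a i)"
      by simp
    then have "poly f (a i) = poly (f mod p) (a i)"
      unfolding poly_add poly_mult root[OF \<open>i \<in> I\<close>] by simp
    then show "L (lagrange_basis a I i) * poly (f mod p) (a i) =
        L (lagrange_basis a I i) * poly f (a i)"
      by simp
  qed
  finally show ?thesis .
qed

end

section \<open>Integration of polynomials\<close>

lemma integrable_poly:
  fixes p :: "real poly"
  assumes "\<And>j. integrable N (\<lambda>x. x ^ j)"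
  shows "integrable N (poly p)"
  unfolding poly_altdef using assms by auto

lemma integral_poly_pos:
  fixes p :: "real poly"
  assumes sets: "sets N = sets (borel_on \<Omega>)"
    and moments: "\<And>j. integrable N (\<lambda>x. x ^ j)"
    and supp: "infinite {x \<in> \<Omega>. \<forall>U. open U \<longrightarrow> x \<in> U \<longrightarrow> emeasure N (U \<inter> \<Omega>) \<noteq> 0}"
    and "p \<noteq> 0" "\<And>x. 0 \<le> poly p x"
  shows "0 < (LINT x|N. poly p x)"
proof (rule ccontr)
  assume "\<not> ?thesis"
  then have "(LINT x|N. poly p x) = 0"
    using assms by (intro antisym integral_nonneg) auto
  then have "AE x in N. poly p x = 0"
    using integral_nonneg_eq_0_iff_AE[OF integrable_poly[OF moments]] assms by simp
  moreover have space: "space N = \<Omega>"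
    using sets_eq_imp_space_eq[OF sets] by (simp add: space_restrict_space)
  define U where "U = {x. poly p x \<noteq> 0}"
  have "open U"
    unfolding U_def by (intro open_Collect_neq continuous_intros)
  then have "U \<inter> \<Omega> \<in> sets N"
    unfolding sets by (auto simp: sets_restrict_space)
  ultimately have null: "emeasure N (U \<inter> \<Omega>) = 0"
    by (subst (asm) AE_iff_measurable) (auto simp: U_def space)
  have "{x \<in> \<Omega>. \<forall>U. open U \<longrightarrow> x \<in> U \<longrightarrow> emeasure N (U \<inter> \<Omega>) \<noteq> 0} \<subseteq> {x. poly p x = 0}"
    using \<open>open U\<close> null by (auto simp: U_def)
  with supp poly_roots_finite[OF \<open>p \<noteq> 0\<close>] show False
    using finite_subset by blast
qed

lemma definite_functional_integral:
  assumes "sets N = sets (borel_on \<Omega>)"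
    and "\<And>j. integrable N (\<lambda>x. x ^ j)"
    and "infinite {x \<in> \<Omega>. \<forall>U. open U \<longrightarrow> x \<in> U \<longrightarrow> emeasure N (U \<inter> \<Omega>) \<noteq> 0}"
  shows "definite_functional (\<lambda>p. LINT x|N. poly p x)"
  using integral_poly_pos[OF assms] integrable_poly[OF assms(2)]
  by unfold_locales simp_all

section \<open>Reduction to a positive measure\<close>

lemma neg_part_nonneg:
  assumes "\<And>A. A \<in> sets M \<Longrightarrow> 0 \<le> \<nu> A"
  shows "neg_part M \<nu> = null_measure M"
proof -
  have "(SUP B\<in>{B \<in> sets M. B \<subseteq> A}. e2ennreal (- \<nu> B)) = 0" for A
    using assms by (auto simp: bot_ennreal e2ennreal_neg intro!: antisym SUP_least)
  then show ?thesis
    unfolding neg_part_def pos_part_def null_measure_def by simp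
qed

lemma pos_part_nonpos:
  assumes "\<And>A. A \<in> sets M \<Longrightarrow> \<nu> A \<le> 0"
  shows "pos_part M \<nu> = null_measure M"
  using neg_part_nonneg[of M "\<lambda>A. - \<nu> A"] assms by (simp add: neg_part_uminus)

lemma sets_pos_part: "sets (pos_part M \<nu>) = sets M"
  unfolding pos_part_def by simp

lemma integral_null_measure_eq_0: "(LINT x|null_measure M. f x) = (0 :: real)"
  by (intro integral_eq_zero_AE AE_I[of _ _ "space M"]) auto

text \<open>
  One of the two parts of \<open>\<nu>\<close> is null, so \<open>N\<close> can be the other one, with \<open>s = 1\<close>
  or \<open>s = - 1\<close>; it is also the total variation, which enters the support.
\<close>

lemma no_sign_change_positive_measure:
  assumes "no_sign_change M \<nu>"
  obtains s :: real and N where "s \<noteq> 0" and "sets N = sets M"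
    and "\<And>f. signed_integral M \<nu> f = s * (LINT x|N. f x)"
    and "\<And>f. signed_integrable M \<nu> f \<Longrightarrow> integrable N f"
    and "\<And>A. emeasure (pos_part M \<nu>) A + emeasure (neg_part M \<nu>) A = emeasure N A"
  using assms unfolding no_sign_change_def
proof
  assume "\<forall>A\<in>sets M. 0 \<le> \<nu> A"
  then show thesis
    using neg_part_nonneg[of M \<nu>]
    by (intro that[of 1 "pos_part M \<nu>"])
      (auto simp: sets_pos_part signed_integral_def signed_integrable_def
        integral_null_measure_eq_0)
next
  assume "\<forall>A\<in>sets M. \<nu> A \<le> 0"
  then show thesis
    using pos_part_nonpos[of M \<nu>]
    by (intro that[of "- 1" "neg_part M \<nu>"])
      (auto simp: sets_pos_part neg_part_def signed_integral_def signed_integrable_def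
        integral_null_measure_eq_0)
qed

section \<open>Gaussian quadrature\<close>

theorem proposition21:
  fixes \<Omega> :: "real set" and \<mu> :: "real set \<Rightarrow> ereal" and P :: "nat \<Rightarrow> real poly" and k :: nat
  assumes "is_interval \<Omega>"
    and "signed_measure (borel_on \<Omega>) \<mu>"
    and "no_sign_change (borel_on \<Omega>) \<mu>"
    and "finite_moments \<Omega> \<mu>"
    and "infinite (measure_support \<Omega> \<mu>)"
    and "monic_orthogonal_polys \<Omega> \<mu> P"
    and "k \<ge> 1"
  shows "card {x. poly (P k) x = 0} = k \<and>
    (\<forall>\<alpha> :: nat \<Rightarrow> real. bij_betw \<alpha> {1..k} {x. poly (P k) x = 0} \<longrightarrow>
      (\<exists>c :: nat \<Rightarrow> real. \<forall>j\<le>2 * k - 1.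
        signed_integral (borel_on \<Omega>) \<mu> (\<lambda>x. x ^ j) = (\<Sum>l=1..k. c l * \<alpha> l ^ j)))"
proof -
  obtain s N where "s \<noteq> 0" and sets: "sets N = sets (borel_on \<Omega>)"
    and int: "\<And>f. signed_integral (borel_on \<Omega>) \<mu> f = s * (LINT x|N. f x)"
    and intble: "\<And>f. signed_integrable (borel_on \<Omega>) \<mu> f \<Longrightarrow> integrable N f"
    and emeasure: "\<And>A. emeasure (pos_part (borel_on \<Omega>) \<mu>) A +
      emeasure (neg_part (borel_on \<Omega>) \<mu>) A = emeasure N A"
    using no_sign_change_positive_measure[OF assms(3)] by blast
  define L where "L = (\<lambda>p. LINT x|N. poly p x)"
  interpret definite_functional L
    unfolding L_def using sets
  proof (rule definite_functional_integral)
    show "integrable N (\<lambda>x. x ^ j)" for j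
      using assms(4) intble by (simp add: finite_moments_def)
    show "infinite {x \<in> \<Omega>. \<forall>U. open U \<longrightarrow> x \<in> U \<longrightarrow> emeasure N (U \<inter> \<Omega>) \<noteq> 0}"
      using assms(5) unfolding measure_support_def emeasure .
  qed
  have deg: "degree (P k) = k"
    using assms(6) by (simp add: monic_orthogonal_polys_def)
  have "L (P k * monom 1 l) = 0" if "l < k" for l
    using assms(6) that \<open>s \<noteq> 0\<close> unfolding monic_orthogonal_polys_def int
    unfolding L_def poly_mult poly_monom by simp
  then have orth: "L (P k * q) = 0" if "degree q < degree (P k)" for q
    using orthogonal_if_monoms that unfolding deg by blast
  have "P k \<noteq> 0"
    using deg \<open>k \<ge> 1\<close> by auto
  have "card {x. poly (P k) x = 0} = k"
    using card_roots_orthogonal[OF \<open>P k \<noteq> 0\<close> orth] deg by simp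
  moreover have "\<exists>c. \<forall>j\<le>2 * k - 1.
      signed_integral (borel_on \<Omega>) \<mu> (\<lambda>x. x ^ j) = (\<Sum>l=1..k. c l * \<alpha> l ^ j)"
    if \<alpha>: "bij_betw \<alpha> {1..k} {x. poly (P k) x = 0}" for \<alpha> :: "nat \<Rightarrow> real"
  proof (intro exI allI impI)
    fix j assume "j \<le> 2 * k - 1"
    then have "degree (monom (1 :: real) j) < 2 * degree (P k)"
      using deg \<open>k \<ge> 1\<close> by (simp add: degree_monom_eq)
    moreover have "poly (P k) (\<alpha> l) = 0" if "l \<in> {1..k}" for l
      using bij_betwE[OF \<alpha>] that by auto
    ultimately have "L (monom 1 j) =
        (\<Sum>l=1..k. L (lagrange_basis \<alpha> {1..k} l) * poly (monom 1 j) (\<alpha> l))"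
      using deg \<alpha> by (intro gauss_quadrature[OF orth]) (auto simp: bij_betw_def)
    then show "signed_integral (borel_on \<Omega>) \<mu> (\<lambda>x. x ^ j) =
        (\<Sum>l=1..k. (s * L (lagrange_basis \<alpha> {1..k} l)) * \<alpha> l ^ j)"
      unfolding int L_def poly_monom by (simp add: sum_distrib_left mult.assoc)
  qed
  ultimately show ?thesis
    by blast
qed

end
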